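(* Roman Vertex Cover, parameterized by the upper bound $k$ on the weight of the solution, is fixed-parameter tractable: it can be decided in time $f(k)\cdot\mathrm{poly}(|V|+|E|)$ for some computable function $f$.
   Context: For a graph $G=(V,E)$, a Roman vertex cover is a pair $(R_1,R_2)$ with $R_1\subseteq E$ and $R_2\subseteq V$ such that every edge $e\in E$ satisfies $e\in R_1$ or $e\cap R_2\ne\emptyset$; its weight is $\omega(R_1,R_2)=|R_1|+2|R_2|$. Roman Vertex Cover: given a graph $G$ and $k\in\mathbb N$, decide whether $G$ has a Roman vertex cover of weight at most $k$. *)

theory Defs
  imports "HOL-Computational_Algebra.Polynomial"
begin

section \<open>Random access machines\<close>

text \<open>
  A configuration consists of a program counter, the contents of the registers (of which a program
  can only name finitely many) and the contents of the random access memory. All cells hold natural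
  numbers. Every instruction costs one time unit; since the only arithmetic operations are addition
  and truncated subtraction, the length of the largest number grows by at most one bit per step
  (up to the constants of the program), so
  running times are polynomially related to those of Turing machines.
\<close>

type_synonym config = "nat \<times> (nat \<Rightarrow> nat) \<times> (nat \<Rightarrow> nat)"

datatype instr =
    Const nat nat
  | Add nat nat nat
  | Sub nat nat nat
  | Load nat nat
  | Store nat nat
  | Jump nat
  | Jump_Zero nat nat

fun exec_instr :: "instr \<Rightarrow> config \<Rightarrow> config" where
  "exec_instr (Const i c) (pc, r, m) = (Suc pc, r(i := c), m)"
| "exec_instr (Add i j l) (pc, r, m) = (Suc pc, r(i := r j + r l), m)"
| "exec_instr (Sub i j l) (pc, r, m) = (Suc pc, r(i := r j - r l), m)"
| "exec_instr (Load i j) (pc, r, m) = (Suc pc, r(i := m (r j)), m)"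
| "exec_instr (Store i j) (pc, r, m) = (Suc pc, r, m(r i := r j))"
| "exec_instr (Jump l) (pc, r, m) = (l, r, m)"
| "exec_instr (Jump_Zero i l) (pc, r, m) = (if r i = 0 then l else Suc pc, r, m)"

text \<open>The machine halts as soon as the program counter leaves the program.\<close>

definition halted :: "instr list \<Rightarrow> config \<Rightarrow> bool" where
  "halted P c \<longleftrightarrow> length P \<le> fst c"

definition step :: "instr list \<Rightarrow> config \<Rightarrow> config" where
  "step P c = (if halted P c then c else exec_instr (P ! fst c) c)"

text \<open>The input is a list of numbers, written to the memory cells from address 0 on; its length is
  given in register 0. Register 0 also holds the output.\<close>

definition init_config :: "nat list \<Rightarrow> config" where
  "init_config xs =
     (0, (\<lambda>_. 0)(0 := length xs), (\<lambda>a. if a < length xs then xs ! a else 0))"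

text \<open>Halted configurations are fixed points of \<^const>\<open>step\<close>, so \<open>t\<close> is an upper bound on the
  number of executed instructions.\<close>

definition computes_within :: "instr list \<Rightarrow> nat list \<Rightarrow> nat \<Rightarrow> nat \<Rightarrow> bool" where
  "computes_within P xs t y \<longleftrightarrow>
     (let c = (step P ^^ t) (init_config xs) in halted P c \<and> fst (snd c) 0 = y)"

definition computable :: "(nat \<Rightarrow> nat) \<Rightarrow> bool" where
  "computable f \<longleftrightarrow> (\<exists>P. \<forall>k. \<exists>t. computes_within P [k] t (f k))"


section \<open>Fixed-parameter tractability\<close>

text \<open>
  A parameterized decision problem is given by the set \<open>I\<close> of its instances, the set \<open>Y\<close> of its
  yes-instances, a parameter \<open>\<kappa>\<close> and a size measure \<open>sz\<close>. The relation \<open>enc\<close> tells which inputs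
  represent an instance; the machine has to answer correctly on every representation.
\<close>

definition fixed_parameter_tractable ::
  "'i set \<Rightarrow> ('i \<Rightarrow> nat list \<Rightarrow> bool) \<Rightarrow> 'i set \<Rightarrow> ('i \<Rightarrow> nat) \<Rightarrow> ('i \<Rightarrow> nat) \<Rightarrow> bool" where
  "fixed_parameter_tractable I enc Y \<kappa> sz \<longleftrightarrow>
     (\<exists>(P :: instr list) (f :: nat \<Rightarrow> nat) (p :: nat poly). computable f \<and>
        (\<forall>i\<in>I. \<forall>xs. enc i xs \<longrightarrow>
           computes_within P xs (f (\<kappa> i) * poly p (sz i)) (if i \<in> Y then 1 else 0)))"


section \<open>Roman Vertex Cover\<close>

definition graph :: "'a set \<Rightarrow> 'a set set \<Rightarrow> bool" where
  "graph V E \<longleftrightarrow> finite V \<and> (\<forall>e\<in>E. e \<subseteq> V \<and> card e = 2)"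

definition roman_vertex_cover ::
  "'a set \<Rightarrow> 'a set set \<Rightarrow> 'a set set \<Rightarrow> 'a set \<Rightarrow> bool" where
  "roman_vertex_cover V E R1 R2 \<longleftrightarrow>
     R1 \<subseteq> E \<and> R2 \<subseteq> V \<and> (\<forall>e\<in>E. e \<in> R1 \<or> e \<inter> R2 \<noteq> {})"

definition rvc_weight :: "'a set set \<Rightarrow> 'a set \<Rightarrow> nat" where
  "rvc_weight R1 R2 = card R1 + 2 * card R2"

text \<open>
  Vertices are natural numbers, without any relation between their values and the size of the graph.
  For the encoding, vertices and edges are enumerated in an arbitrary order and each edge is given
  by the positions of its two ends, in either order.
\<close>

type_synonym rvc_instance = "nat set \<times> nat set set \<times> nat"

definition rvc_instances :: "rvc_instance set" where
  "rvc_instances = {(V, E, k). graph V E}"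

definition rvc_yes :: "rvc_instance set" where
  "rvc_yes = {(V, E, k). graph V E \<and>
     (\<exists>R1 R2. roman_vertex_cover V E R1 R2 \<and> rvc_weight R1 R2 \<le> k)}"

definition rvc_encoding :: "rvc_instance \<Rightarrow> nat list \<Rightarrow> bool" where
  "rvc_encoding = (\<lambda>(V, E, k) xs. \<exists>vs es.
     distinct vs \<and> set vs = V \<and>
     (\<forall>(i, j)\<in>set es. i < length vs \<and> j < length vs) \<and>
     distinct (map (\<lambda>(i, j). {vs ! i, vs ! j}) es) \<and>
     set (map (\<lambda>(i, j). {vs ! i, vs ! j}) es) = E \<and>
     xs = k # length vs # length es # concat (map (\<lambda>(i, j). [i, j]) es))"

definition rvc_parameter :: "rvc_instance \<Rightarrow> nat" where
  "rvc_parameter = (\<lambda>(V, E, k). k)"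

definition rvc_size :: "rvc_instance \<Rightarrow> nat" where
  "rvc_size = (\<lambda>(V, E, k). card V + card E)"

lemma rvc_encoding_exists:
  assumes "i \<in> rvc_instances"
  shows "\<exists>xs. rvc_encoding i xs"
proof -
  obtain V E k where i: "i = (V, E, k)" by (cases i)
  have fV: "finite V" and E: "\<And>e. e \<in> E \<Longrightarrow> e \<subseteq> V \<and> card e = 2"
    using assms by (auto simp: i rvc_instances_def graph_def)
  have "E \<subseteq> Pow V" using E by blast
  then have "finite E" using fV by (meson finite_Pow_iff finite_subset)
  then obtain ls where ls: "distinct ls" "set ls = E"
    using finite_distinct_list by blast
  obtain vs where vs: "distinct vs" "set vs = V"
    using fV finite_distinct_list by blast
  have "\<exists>q. fst q < length vs \<and> snd q < length vs \<and> {vs ! fst q, vs ! snd q} = e"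
    if e: "e \<in> E" for e
  proof -
    obtain u v where uv: "e = {u, v}"
      using E[OF e] by (auto simp: card_2_iff)
    then have "u \<in> set vs" "v \<in> set vs" using E[OF e] vs by auto
    then obtain a b where "a < length vs" "b < length vs" "vs ! a = u" "vs ! b = v"
      by (auto simp: in_set_conv_nth)
    then show ?thesis using uv by (intro exI[of _ "(a, b)"]) simp
  qed
  then obtain q where q: "\<And>e. e \<in> E \<Longrightarrow> fst (q e) < length vs \<and> snd (q e) < length vs \<and>
      {vs ! fst (q e), vs ! snd (q e)} = e"
    by metis
  have m: "map (\<lambda>(i, j). {vs ! i, vs ! j}) (map q ls) = ls"
    using q ls by (auto simp: case_prod_unfold intro!: map_idI)
  have b: "\<forall>(i, j)\<in>set (map q ls). i < length vs \<and> j < length vs"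
    using q ls by (auto simp: case_prod_unfold)
  show ?thesis
    unfolding i rvc_encoding_def prod.case
    using vs ls m b by metis
qed

end

theory Submission
  imports Defs
begin

text \<open>
  Bounded search tree: an edge not yet covered must be put into \<open>R\<^sub>1\<close> at cost 1, or one of its ends
  must be put into \<open>R\<^sub>2\<close> at cost 2, so at most \<open>k\<close> ternary decisions are made. Instead of
  backtracking, the machine runs through all numbers \<open>s < 3 ^ k\<close> and, in one pass over the edges,
  carries out the decisions given by the base-3 digits of \<open>s\<close>. Digits are extracted by
  repeated subtraction, which costs another factor \<open>3 ^ k\<close>; the total time is \<open>9 ^ k\<close> times
  a linear function of the number of edges.
\<close>

section \<open>Reachability within a time bound\<close>

text \<open>Only an upper bound on the step count is kept, so that branches of different length
  share one bound and bounds add up under composition.\<close>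

definition reaches :: "instr list \<Rightarrow> nat \<Rightarrow> config \<Rightarrow> config \<Rightarrow> bool" where
  "reaches P t c c' \<longleftrightarrow> (\<exists>t'\<le>t. (step P ^^ t') c = c')"

lemma reachesI: "(step P ^^ t) c = c' \<Longrightarrow> reaches P t c c'"
  unfolding reaches_def by blast

lemma reaches_trans:
  assumes "reaches P t c c'" and "reaches P u c' c''"
  shows "reaches P (t + u) c c''"
proof -
  obtain t' u' where "t' \<le> t" "u' \<le> u" "(step P ^^ t') c = c'" "(step P ^^ u') c' = c''"
    using assms unfolding reaches_def by blast
  then have "t' + u' \<le> t + u" "(step P ^^ (t' + u')) c = c''"
    by (auto simp: add.commute[of t'] funpow_add)
  then show ?thesis unfolding reaches_def by blast
qed

lemma reaches_mono: "reaches P t c c' \<Longrightarrow> t \<le> u \<Longrightarrow> reaches P u c c'"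
  unfolding reaches_def by (blast intro: le_trans)

lemma funpow_step_halted: "halted P c \<Longrightarrow> (step P ^^ t) c = c"
  by (induction t) (auto simp: step_def)

text \<open>A halted configuration is a fixed point of \<open>step\<close>, so a run that halts
  early can be padded to exactly \<open>t\<close> steps.\<close>

lemma computes_withinI:
  assumes "reaches P t (init_config xs) (pc, r, m)" and "length P \<le> pc" and "r 0 = y"
  shows "computes_within P xs t y"
proof -
  obtain t' where t': "t' \<le> t" "(step P ^^ t') (init_config xs) = (pc, r, m)"
    using assms(1) unfolding reaches_def by blast
  have h: "halted P (pc, r, m)" using assms(2) by (simp add: halted_def)
  have "(step P ^^ t) (init_config xs) = (step P ^^ (t - t')) ((step P ^^ t') (init_config xs))"
    using t'(1) by (simp flip: funpow_add comp_apply[of "step P ^^ (t - t')"])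
  then have "(step P ^^ t) (init_config xs) = (pc, r, m)"
    using t'(2) funpow_step_halted[OF h] by simp
  then show ?thesis using h assms(3) by (simp add: computes_within_def)
qed


section \<open>Symbolic execution\<close>

text \<open>A list padded with 0 makes the register file an explicit term, on which the simplifier
  runs straight-line code as list updates.\<close>

definition regs :: "nat list \<Rightarrow> nat \<Rightarrow> nat" where
  "regs l i = (if i < length l then l ! i else 0)"

lemma regs_upd: "i < length l \<Longrightarrow> (regs l)(i := x) = regs (l[i := x])"
  by (rule ext) (auto simp: regs_def)

lemma regs_nth: "i < length l \<Longrightarrow> regs l i = l ! i"
  by (simp add: regs_def)

lemma list_update_numeral: "(x # l)[numeral n := y] = x # l[pred_numeral n := y]"
  by (simp add: numeral_eq_Suc)

lemma funpow_numeral: "(f ^^ numeral n) x = (f ^^ pred_numeral n) (f x)"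
  by (simp add: numeral_eq_Suc funpow_swap1)

lemma step_exec: "pc < length P \<Longrightarrow> step P (pc, r, m) = exec_instr (P ! pc) (pc, r, m)"
  by (simp add: step_def halted_def)

lemmas exec_simps = step_exec regs_upd regs_nth list_update_numeral funpow_numeral

text \<open>The number \<open>n\<close> of zeros is free; it is chosen to reach every register that
  the program names.\<close>

lemma init_config_regs:
  "init_config xs = (0, regs (length xs # replicate n 0),
     (\<lambda>a. if a < length xs then xs ! a else 0))"
  by (auto simp: init_config_def regs_def fun_eq_iff nth_Cons split: nat.split)


section \<open>Powers of nine are computable\<close>

text \<open>Each pass multiplies register 0 by nine, adding to it its eightfold obtained by three
  doublings; register 1 counts down. The first \<open>Load\<close> reads address 0, since register 2
  is still 0.\<close>

definition pow9_prog :: "instr list" where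
  "pow9_prog =
    [Load 1 2, Const 2 1, Const 0 1,
     Jump_Zero 1 10, Add 3 0 0, Add 3 3 3, Add 3 3 3, Add 0 3 0, Sub 1 1 2, Jump 3]"

lemma pow9_prog_loop:
  "\<exists>r. reaches pow9_prog (7 * i + 1) (3, regs [a, i, 1, z], m) (10, r, m) \<and> r 0 = a * 9 ^ i"
proof (induction i arbitrary: a z)
  case 0
  have "(step pow9_prog ^^ 1) (3, regs [a, 0, 1, z], m) = (10, regs [a, 0, 1, z], m)"
    by (simp add: exec_simps pow9_prog_def)
  then have "reaches pow9_prog 1 (3, regs [a, 0, 1, z], m) (10, regs [a, 0, 1, z], m)"
    by (rule reachesI)
  then show ?case by (intro exI[of _ "regs [a, 0, 1, z]"]) (simp add: regs_nth)
next
  case (Suc i)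
  have "(step pow9_prog ^^ 7) (3, regs [a, Suc i, 1, z], m) = (3, regs [a * 9, i, 1, a * 8], m)"
    by (simp add: exec_simps pow9_prog_def) (rule arg_cong[where f = regs], simp)
  then have "reaches pow9_prog 7 (3, regs [a, Suc i, 1, z], m) (3, regs [a * 9, i, 1, a * 8], m)"
    by (rule reachesI)
  moreover obtain r where
    "reaches pow9_prog (7 * i + 1) (3, regs [a * 9, i, 1, a * 8], m) (10, r, m)"
    "r 0 = a * 9 * 9 ^ i"
    using Suc by blast
  ultimately show ?case
    by (intro exI[of _ r] conjI) (auto dest: reaches_trans simp: algebra_simps)
qed

lemma computable_pow9: "computable (\<lambda>k. 9 ^ k)"
  unfolding computable_def
proof (intro exI[of _ pow9_prog] allI)
  fix k :: nat
  define m where "m = (\<lambda>a. if a < length [k] then [k] ! a else 0)"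
  have "(step pow9_prog ^^ 3) (init_config [k]) = (3, regs [1, k, 1, 0], m)"
    by (simp add: init_config_regs[of _ 3] exec_simps pow9_prog_def m_def numeral_eq_Suc)
  then have "reaches pow9_prog 3 (init_config [k]) (3, regs [1, k, 1, 0], m)"
    by (rule reachesI)
  moreover obtain r where
    "reaches pow9_prog (7 * k + 1) (3, regs [1, k, 1, 0], m) (10, r, m)" "r 0 = 1 * 9 ^ k"
    using pow9_prog_loop by blast
  ultimately have "computes_within pow9_prog [k] (3 + (7 * k + 1)) (9 ^ k)"
    by (intro computes_withinI[OF reaches_trans, of _ _ _ _ _ 10 r m]) (simp_all add: pow9_prog_def)
  then show "\<exists>t. computes_within pow9_prog [k] t (9 ^ k)" by blast
qed


section \<open>Branching along a guess\<close>

text \<open>The base-3 digits of \<open>s\<close> are the branching decisions: an edge that the vertices in \<open>M\<close> do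
  not cover is paid for itself (digit 0), or by its first (1) or second (2) end.\<close>

fun guess_ok :: "nat \<Rightarrow> nat \<Rightarrow> 'a set \<Rightarrow> ('a \<times> 'a) list \<Rightarrow> bool" where
  "guess_ok s b M [] = True"
| "guess_ok s b M ((u, v) # es) =
     (if u \<in> M \<or> v \<in> M then guess_ok s b M es
      else if b = 0 then False
      else if s mod 3 = 0 then guess_ok (s div 3) (b - 1) M es
      else if b = 1 then False
      else guess_ok (s div 3) (b - 2) (insert (if s mod 3 = 1 then u else v) M) es)"

abbreviation uncovered :: "'a set \<Rightarrow> ('a \<times> 'a) list \<Rightarrow> ('a \<times> 'a) list" where
  "uncovered M \<equiv> filter (\<lambda>(u, v). u \<notin> M \<and> v \<notin> M)"

text \<open>\<open>R\<close> collects the vertices chosen by digits 1 and 2. The budget pays 2 for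
  each of them and 1 for each edge with digit 0; if a later choice covers such an edge, the bound
  only gets slacker.\<close>

lemma guess_ok_sound:
  "guess_ok s b M es \<Longrightarrow> \<exists>R. finite R \<and> length (uncovered (M \<union> R) es) + 2 * card R \<le> b"
proof (induction s b M es rule: guess_ok.induct)
  case (1 s b M)
  show ?case by (intro exI[of _ "{}"]) simp
next
  case (2 s b M u v es)
  consider (covered) "u \<in> M \<or> v \<in> M"
    | (edge) "\<not> (u \<in> M \<or> v \<in> M)" "b \<noteq> 0" "s mod 3 = 0"
    | (vertex) "\<not> (u \<in> M \<or> v \<in> M)" "b \<noteq> 0" "s mod 3 \<noteq> 0" "b \<noteq> 1"
    using "2.prems" by (auto split: if_splits)
  then show ?case
  proof cases
    case covered
    then show ?thesis using "2.IH"(1) "2.prems" by auto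
  next
    case edge
    then obtain R where "finite R" "length (uncovered (M \<union> R) es) + 2 * card R \<le> b - 1"
      using "2.IH"(2) "2.prems" by auto
    then show ?thesis using edge by (intro exI[of _ R]) auto
  next
    case vertex
    define w where "w = (if s mod 3 = 1 then u else v)"
    obtain R where R: "finite R" "length (uncovered (insert w M \<union> R) es) + 2 * card R \<le> b - 2"
      using "2.IH"(3) "2.prems" vertex unfolding w_def by auto
    \<comment> \<open>\<open>w\<close> is an end of the new edge, so choosing it removes that edge
      from the list.\<close>
    have "uncovered (M \<union> insert w R) ((u, v) # es) = uncovered (insert w M \<union> R) es"
      by (auto simp: w_def)
    moreover have "card (insert w R) \<le> Suc (card R)"
      by (simp add: card_insert_le_m1 card_insert_if R(1))
    ultimately show ?thesis using R vertex by (intro exI[of _ "insert w R"]) auto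
  qed
qed

text \<open>The guess is read off \<open>R\<close>: an edge not yet covered gets the digit of an end
  in \<open>R\<close>, or 0 if there is none. A chosen vertex moves from \<open>R\<close> to
  \<open>M\<close>, so \<open>M \<union> R\<close> stays fixed. Every digit costs budget, so
  \<open>b\<close> digits suffice.\<close>

lemma guess_ok_complete:
  "finite R \<Longrightarrow> length (uncovered (M \<union> R) es) + 2 * card R \<le> b \<Longrightarrow> \<exists>s<3 ^ b. guess_ok s b M es"
proof (induction es arbitrary: b M R)
  case Nil
  show ?case by (intro exI[of _ 0]) simp
next
  case (Cons e es)
  obtain u v where e: "e = (u, v)" by (cases e)
  have vertex: "\<exists>s<3 ^ b. guess_ok s b M (e # es)"
    if w: "w \<in> R" "(w, d) \<in> {(u, 1), (v, 2)}" and M: "u \<notin> M" "v \<notin> M" for w and d :: nat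
  proof -
    have card: "card R = Suc (card (R - {w}))"
      using w Cons.prems(1) by (metis card_Suc_Diff1)
    have eq: "insert w M \<union> (R - {w}) = M \<union> R" using w by auto
    have "length (uncovered (M \<union> R) es) \<le> length (uncovered (M \<union> R) (e # es))"
      by simp
    then have le: "length (uncovered (insert w M \<union> (R - {w})) es) + 2 * card (R - {w}) + 2 \<le> b"
      using Cons.prems(2) card unfolding eq by linarith
    then have "2 \<le> b" by linarith
    then obtain c where "b = 2 + c" using le_Suc_ex by blast
    then have b: "b = Suc (Suc c)" by simp
    have "length (uncovered (insert w M \<union> (R - {w})) es) + 2 * card (R - {w}) \<le> c"
      using le b by linarith
    then obtain s where s: "s < 3 ^ c" "guess_ok s c (insert w M) es"
      using Cons.IH[of "R - {w}" "insert w M" c] Cons.prems(1) by blast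
    have d: "d = 1 \<or> d = 2" using w by auto
    have "guess_ok (d + 3 * s) b M (e # es)"
      using w(2) M s(2) by (auto simp: e b)
    \<comment> \<open>One digit is prepended while the budget grows by two, so there is room to
      spare.\<close>
    moreover have "d + 3 * s < 3 ^ b" using s(1) d by (auto simp: b)
    ultimately show ?thesis by blast
  qed
  show ?case
  proof (cases "u \<in> M \<or> v \<in> M")
    case True
    then show ?thesis using Cons.IH[of R M b] Cons.prems by (auto simp: e)
  next
    case M: False
    show ?thesis
    proof (cases "u \<in> R \<or> v \<in> R")
      case True
      then show ?thesis using vertex[of u 1] vertex[of v 2] M by auto
    next
      case False
      \<comment> \<open>The edge itself counts as uncovered, hence the budget is positive.\<close>
      then obtain c where b: "b = Suc c" "length (uncovered (M \<union> R) es) + 2 * card R \<le> c"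
        using M Cons.prems(2) by (cases b) (auto simp: e)
      then obtain s where s: "s < 3 ^ c" "guess_ok s c M es"
        using Cons.IH Cons.prems(1) by blast
      have "guess_ok (3 * s) b M (e # es)" using M s(2) by (simp add: e b(1))
      moreover have "3 * s < 3 ^ b" using s(1) by (simp add: b(1))
      ultimately show ?thesis by blast
    qed
  qed
qed

lemma guess_ok_iff_rvc_yes:
  assumes G: "graph V E" and vs: "distinct vs" "set vs = V"
    and es: "\<forall>(i, j)\<in>set es. i < length vs \<and> j < length vs"
    and d: "distinct (map (\<lambda>(i, j). {vs ! i, vs ! j}) es)"
    and E: "set (map (\<lambda>(i, j). {vs ! i, vs ! j}) es) = E"
  shows "(\<exists>s<3 ^ k. guess_ok s k {} es) \<longleftrightarrow> (V, E, k) \<in> rvc_yes"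
proof
  let ?g = "\<lambda>(i, j). {vs ! i, vs ! j}"
  assume "\<exists>s<3 ^ k. guess_ok s k {} es"
  then obtain R where R: "finite R" "length (uncovered R es) + 2 * card R \<le> k"
    using guess_ok_sound[of _ k "{}" es] by auto
  \<comment> \<open>\<open>guess_ok_sound\<close> does not confine \<open>R\<close> to positions in
    \<open>vs\<close>, hence the intersection; ends of edges are valid positions, so covered edges
    stay covered.\<close>
  define R2 where "R2 = (\<lambda>i. vs ! i) ` (R \<inter> {..<length vs})"
  define R1 where "R1 = set (map ?g (uncovered R es))"
  have "card R2 \<le> card R"
    unfolding R2_def by (meson Int_lower1 R(1) card_image_le card_mono finite_Int le_trans)
  moreover have "card R1 \<le> length (uncovered R es)"
    unfolding R1_def by (metis card_length length_map)
  ultimately have "rvc_weight R1 R2 \<le> k"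
    using R(2) by (simp add: rvc_weight_def)
  moreover have "roman_vertex_cover V E R1 R2"
    unfolding roman_vertex_cover_def
  proof (intro conjI ballI)
    show "R1 \<subseteq> E" using E by (auto simp: R1_def)
    show "R2 \<subseteq> V" using vs by (auto simp: R2_def)
    fix e assume "e \<in> E"
    then obtain i j where ij: "(i, j) \<in> set es" "e = {vs ! i, vs ! j}"
      using E by auto
    then have "i < length vs" "j < length vs" using es by auto
    then show "e \<in> R1 \<or> e \<inter> R2 \<noteq> {}"
      using ij by (cases "i \<in> R \<or> j \<in> R") (force simp: R1_def R2_def)+
  qed
  ultimately show "(V, E, k) \<in> rvc_yes" using G by (auto simp: rvc_yes_def)
next
  let ?g = "\<lambda>(i, j). {vs ! i, vs ! j}"
  assume "(V, E, k) \<in> rvc_yes"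
  then obtain R1 R2 where rvc: "roman_vertex_cover V E R1 R2" and w: "rvc_weight R1 R2 \<le> k"
    by (auto simp: rvc_yes_def)
  define R where "R = {i. i < length vs \<and> vs ! i \<in> R2}"
  have fin: "finite R" by (simp add: R_def)
  have "finite R2" using rvc vs by (auto simp: roman_vertex_cover_def intro: finite_subset)
  then have "card R \<le> card R2"
    using vs(1) by (intro card_inj_on_le[of "\<lambda>i. vs ! i"])
      (auto simp: R_def inj_on_def nth_eq_iff_index_eq)
  moreover have "length (uncovered R es) \<le> card R1"
  proof -
    have "finite R1"
      using rvc E by (auto simp: roman_vertex_cover_def intro: finite_subset)
    moreover have "set (map ?g (uncovered R es)) \<subseteq> R1"
    proof
      fix e assume "e \<in> set (map ?g (uncovered R es))"
      then obtain i j where ij: "(i, j) \<in> set es" "i \<notin> R" "j \<notin> R" "e = {vs ! i, vs ! j}"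
        by auto
      then have "e \<in> E" "e \<inter> R2 = {}" using E es by (auto simp: R_def image_iff)
      then show "e \<in> R1" using rvc by (auto simp: roman_vertex_cover_def)
    qed
    \<comment> \<open>Without repetitions, the length of the list of uncovered edges is a
      cardinality and can be compared with \<open>card R1\<close>.\<close>
    moreover have "distinct (map ?g (uncovered R es))"
      using d by (rule distinct_map_filter)
    ultimately show ?thesis
      by (metis card_mono distinct_card length_map)
  qed
  ultimately have "length (uncovered ({} \<union> R) es) + 2 * card R \<le> k"
    using w by (simp add: rvc_weight_def)
  then show "\<exists>s<3 ^ k. guess_ok s k {} es"
    using guess_ok_complete[OF fin] by blast
qed


section \<open>The machine program\<close>

text \<open>
  Registers 1, 2 and 11 hold the constants 1, 2 and 0, register 3 the budget \<open>k\<close>, register 12 the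
  number \<open>3 ^ k\<close> of guesses and register 4 the number of guesses tried so far. Register 0 keeps the
  length \<open>n\<close> of the input, which is both the end of the edge list and the start of the array of marks.
  A vertex is marked in the current round iff its cell holds the round number; earlier rounds leave
  smaller numbers, so the marks are never cleared.

  Lines 0--9 compute \<open>3 ^ k\<close>; a round starts at line 10, and line 16 takes the next edge; lines 30--35
  divide the guess by 3; lines 36--47 carry out a branching decision.
\<close>

definition rvc_prog :: "instr list" where
  "rvc_prog =
    [Const 1 1, Const 2 2, Load 3 4, Const 12 1, Add 5 3 11,
     Jump_Zero 5 10, Add 6 12 12, Add 12 6 12, Sub 5 5 1, Jump 5,
     Sub 5 12 4, Jump_Zero 5 48, Add 5 4 11, Add 4 4 1, Add 6 3 11, Const 7 3,
     Sub 8 0 7, Jump_Zero 8 50,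
     Load 8 7, Add 8 8 0, Add 7 7 1, Load 9 7, Add 9 9 0, Add 7 7 1,
     Load 10 8, Sub 10 4 10, Jump_Zero 10 16,
     Load 10 9, Sub 10 4 10, Jump_Zero 10 16,
     Const 10 0, Sub 13 5 2, Jump_Zero 13 36, Sub 5 13 1, Add 10 10 1, Jump 31,
     Jump_Zero 6 10, Sub 6 6 1, Jump_Zero 5 46, Jump_Zero 6 10, Sub 6 6 1,
     Sub 5 5 1, Jump_Zero 5 45, Store 9 4, Jump 46, Store 8 4, Add 5 10 11, Jump 16,
     Const 0 0, Jump 51, Const 0 1]"

text \<open>During an edge scan, \<open>j\<close> is the round number, \<open>s\<close> the rest of
  the guess, \<open>b\<close> the budget left, \<open>p\<close> the address of the next edge,
  \<open>x\<close> and \<open>y\<close> the mark cells of the ends of the edge just fetched,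
  \<open>q\<close> the quotient and \<open>z\<close> the scratch value of the division.\<close>

abbreviation ram ::
  "nat \<Rightarrow> nat \<Rightarrow> nat \<Rightarrow> nat \<Rightarrow> nat \<Rightarrow> nat \<Rightarrow> nat \<Rightarrow> nat \<Rightarrow> nat \<Rightarrow> nat \<Rightarrow> nat \<Rightarrow> nat \<Rightarrow> nat" where
  "ram n k N j s b p x y q z \<equiv> regs [n, 1, 2, k, j, s, b, p, x, y, q, 0, N, z]"

section \<open>Arithmetic loops: powers of three and base-3 digits\<close>

lemma power_loop:
  "\<exists>b'. reaches rvc_prog (5 * i + 1) (5, ram n k N j i b p x y q z, m)
     (10, ram n k (N * 3 ^ i) j 0 b' p x y q z, m)"
proof (induction i arbitrary: N b)
  case 0
  have "(step rvc_prog ^^ 1) (5, ram n k N j 0 b p x y q z, m) = (10, ram n k N j 0 b p x y q z, m)"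
    by (simp add: exec_simps rvc_prog_def)
  from reachesI[OF this] show ?case by auto
next
  case (Suc i)
  have "(step rvc_prog ^^ 5) (5, ram n k N j (Suc i) b p x y q z, m) =
      (5, ram n k (N + N + N) j i (N + N) p x y q z, m)"
    by (simp add: exec_simps rvc_prog_def)
  note head = reachesI[OF this]
  obtain b' where "reaches rvc_prog (5 * i + 1) (5, ram n k (N + N + N) j i (N + N) p x y q z, m)
     (10, ram n k ((N + N + N) * 3 ^ i) j 0 b' p x y q z, m)"
    using Suc by blast
  moreover have "(N + N + N) * 3 ^ i = N * 3 ^ Suc i" by simp
  ultimately have "reaches rvc_prog (5 + (5 * i + 1)) (5, ram n k N j (Suc i) b p x y q z, m)
      (10, ram n k (N * 3 ^ Suc i) j 0 b' p x y q z, m)"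
    using reaches_trans[OF head] by metis
  then show ?case by auto
qed

text \<open>Truncated \<open>s - 2\<close> is zero exactly if \<open>s < 3\<close>, which gives the
  exit test; otherwise one less than it is the next dividend.\<close>

lemma division_loop:
  "reaches rvc_prog (5 * (s div 3) + 2) (31, ram n k N j s b p x y q z, m)
     (36, ram n k N j (s mod 3) b p x y (q + s div 3) 0, m)"
proof (induction s arbitrary: q z rule: less_induct)
  case (less s)
  show ?case
  proof (cases "s \<le> 2")
    case True
    then have "(step rvc_prog ^^ 2) (31, ram n k N j s b p x y q z, m) =
        (36, ram n k N j s b p x y q 0, m)"
      by (simp add: exec_simps rvc_prog_def)
    from reachesI[OF this] show ?thesis using True by (simp del: add_2_eq_Suc')
  next
    case False
    then have "3 \<le> s" by simp
    then obtain s' where s: "s = s' + 3" by (metis add.commute le_Suc_ex)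
    have "(step rvc_prog ^^ 5) (31, ram n k N j s b p x y q z, m) =
        (31, ram n k N j s' b p x y (Suc q) (Suc s'), m)"
      by (simp add: exec_simps rvc_prog_def s)
    from reaches_trans[OF reachesI[OF this] less[of s']] show ?thesis
      by (simp add: s)
  qed
qed

section \<open>Processing the edges for one guess\<close>

fun edges_at :: "(nat \<Rightarrow> nat) \<Rightarrow> nat \<Rightarrow> (nat \<times> nat) list \<Rightarrow> bool" where
  "edges_at m p [] = True"
| "edges_at m p ((u, v) # es) = (m p = u \<and> m (Suc p) = v \<and> edges_at m (Suc (Suc p)) es)"

lemma edges_at_cong:
  "(\<And>a. a < p + 2 * length es \<Longrightarrow> m' a = m a) \<Longrightarrow> edges_at m' p es = edges_at m p es"
  by (induction m p es rule: edges_at.induct) auto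

text \<open>The code tests whether \<open>j\<close> minus the mark is 0, which means equality
  because marks never exceed \<open>j\<close>. The three paths take 11, 14 and 15 steps.\<close>

lemma fetch_edge:
  assumes "m p = u" and "m (Suc p) = v" and "p < n" and "m (u + n) \<le> j" and "m (v + n) \<le> j"
  shows "\<exists>q'. reaches rvc_prog 15 (16, ram n k N j s b p x y q z, m)
    (if m (u + n) = j \<or> m (v + n) = j then 16 else 31,
     ram n k N j s b (Suc (Suc p)) (u + n) (v + n) q' z, m) \<and>
    (m (u + n) = j \<or> m (v + n) = j \<or> q' = 0)"
proof -
  consider (u) "m (u + n) = j" | (v) "m (u + n) < j" "m (v + n) = j"
    | (none) "m (u + n) < j" "m (v + n) < j"
    using assms by linarith
  then show ?thesis
  proof cases
    case u
    have "(step rvc_prog ^^ 11) (16, ram n k N j s b p x y q z, m) =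
        (16, ram n k N j s b (Suc (Suc p)) (u + n) (v + n) 0 z, m)"
      using assms u by (simp add: exec_simps rvc_prog_def)
    from reaches_mono[OF reachesI[OF this], of 15] show ?thesis using u by auto
  next
    case v
    have "(step rvc_prog ^^ 14) (16, ram n k N j s b p x y q z, m) =
        (16, ram n k N j s b (Suc (Suc p)) (u + n) (v + n) 0 z, m)"
      using assms v by (simp add: exec_simps rvc_prog_def)
    from reaches_mono[OF reachesI[OF this], of 15] show ?thesis using v by auto
  next
    case none
    have "(step rvc_prog ^^ 15) (16, ram n k N j s b p x y q z, m) =
        (31, ram n k N j s b (Suc (Suc p)) (u + n) (v + n) 0 z, m)"
      using assms none by (simp add: exec_simps rvc_prog_def)
    from reachesI[OF this] show ?thesis using none by auto
  qed
qed

text \<open>Address 10 starts the next guess, address 16 the next edge. The common bound 11 is the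
  longest path, the one marking the second end.\<close>

lemma branch_fail:
  assumes "b = 0 \<or> b = 1 \<and> d \<noteq> 0"
  shows "\<exists>b'. reaches rvc_prog 11 (36, ram n k N j d b p x y q z, m)
    (10, ram n k N j d b' p x y q z, m)"
proof (cases "b = 0")
  case True
  then have "(step rvc_prog ^^ 1) (36, ram n k N j d b p x y q z, m) =
      (10, ram n k N j d b p x y q z, m)"
    by (simp add: exec_simps rvc_prog_def)
  from reaches_mono[OF reachesI[OF this], of 11] show ?thesis by auto
next
  case False
  then have "(step rvc_prog ^^ 4) (36, ram n k N j d b p x y q z, m) =
      (10, ram n k N j d 0 p x y q z, m)"
    using assms by (simp add: exec_simps rvc_prog_def)
  from reaches_mono[OF reachesI[OF this], of 11] show ?thesis by auto
qed

lemma branch_edge: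
  "reaches rvc_prog 11 (36, ram n k N j 0 (Suc b) p x y q z, m) (16, ram n k N j q b p x y q z, m)"
proof -
  have "(step rvc_prog ^^ 5) (36, ram n k N j 0 (Suc b) p x y q z, m) =
      (16, ram n k N j q b p x y q z, m)"
    by (simp add: exec_simps rvc_prog_def)
  from reaches_mono[OF reachesI[OF this], of 11] show ?thesis by auto
qed

lemma branch_vertex:
  assumes "d = 1 \<or> d = 2"
  shows "reaches rvc_prog 11 (36, ram n k N j d (Suc (Suc b)) p x y q z, m)
    (16, ram n k N j q b p x y q z, m((if d = 1 then x else y) := j))"
proof (cases "d = 1")
  case True
  then have "(step rvc_prog ^^ 10) (36, ram n k N j d (Suc (Suc b)) p x y q z, m) =
      (16, ram n k N j q b p x y q z, m(x := j))"
    by (simp add: exec_simps rvc_prog_def)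
  from reaches_mono[OF reachesI[OF this], of 11] show ?thesis using True by auto
next
  case False
  then have "(step rvc_prog ^^ 11) (36, ram n k N j d (Suc (Suc b)) p x y q z, m) =
      (16, ram n k N j q b p x y q z, m(y := j))"
    using assms by (simp add: exec_simps rvc_prog_def)
  from reachesI[OF this] show ?thesis using False by auto
qed

text \<open>Invariant: the vertices with mark \<open>j\<close> form the set \<open>M\<close> of
  \<open>guess_ok\<close>. Marks lie from address \<open>n\<close> on, so the edge list stays
  intact. An edge costs at most 15 steps for fetching, \<open>5 * (s div 3) + 2\<close> for the
  digit and 11 for branching, where \<open>5 * (s div 3) \<le> 2 * s\<close>.\<close>

lemma scan_edges:
  assumes "edges_at m p es" and "n = p + 2 * length es" and "\<And>a. n \<le> a \<Longrightarrow> m a \<le> j"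
  shows "\<exists>s' b' p' x' y' q' z' m'.
    reaches rvc_prog (length es * (2 * s + 30) + 2) (16, ram n k N j s b p x y q z, m)
      (if guess_ok s b {v. m (v + n) = j} es then 50 else 10,
       ram n k N j s' b' p' x' y' q' z', m') \<and>
    (\<forall>a<n. m' a = m a) \<and> (\<forall>a\<ge>n. m' a \<le> j)"
  using assms
proof (induction es arbitrary: m p s b x y q z)
  case Nil
  have "(step rvc_prog ^^ 2) (16, ram n k N j s b p x y q z, m) =
      (50, ram n k N j s b p 0 y q z, m)"
    using Nil by (simp add: exec_simps rvc_prog_def)
  note r = reachesI[OF this]
  show ?case
    by (rule exI[of _ s], rule exI[of _ b], rule exI[of _ p], rule exI[of _ 0], rule exI[of _ y],
        rule exI[of _ q], rule exI[of _ z], rule exI[of _ m]) (use r Nil in \<open>simp del: add_2_eq_Suc'\<close>)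
next
  case (Cons e es)
  obtain u v where e: "e = (u, v)" by (cases e)
  define M where "M = {v. m (v + n) = j}"
  have at: "m p = u" "m (Suc p) = v" "edges_at m (Suc (Suc p)) es"
    and n: "n = Suc (Suc p) + 2 * length es"
    using Cons.prems by (auto simp: e)
  note IH = Cons.IH[OF _ n]
  have pn: "p < n" using n by simp
  have marks: "m (u + n) \<le> j" "m (v + n) \<le> j" using Cons.prems(3) by simp_all
  obtain q0 where fetch: "reaches rvc_prog 15 (16, ram n k N j s b p x y q z, m)
      (if u \<in> M \<or> v \<in> M then 16 else 31,
       ram n k N j s b (Suc (Suc p)) (u + n) (v + n) q0 z, m)"
    and q0: "u \<in> M \<or> v \<in> M \<or> q0 = 0"
    using fetch_edge[OF at(1,2) pn marks, where k = k and N = N and s = s and b = b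
        and x = x and y = y and q = q and z = z]
    unfolding M_def mem_Collect_eq by blast
  show ?case
  proof (cases "u \<in> M \<or> v \<in> M")
    case True
    obtain s' b' p' x' y' q' z' m' where
      r: "reaches rvc_prog (length es * (2 * s + 30) + 2)
          (16, ram n k N j s b (Suc (Suc p)) (u + n) (v + n) q0 z, m)
        (if guess_ok s b M es then 50 else 10, ram n k N j s' b' p' x' y' q' z', m')"
      and inv: "\<forall>a<n. m' a = m a" "\<forall>a\<ge>n. m' a \<le> j"
      using IH[OF at(3) Cons.prems(3), where s = s and b = b and x = "u + n" and y = "v + n"
          and q = q0 and z = z] unfolding M_def by blast
    have "reaches rvc_prog (15 + (length es * (2 * s + 30) + 2)) (16, ram n k N j s b p x y q z, m)
        (if guess_ok s b M (e # es) then 50 else 10, ram n k N j s' b' p' x' y' q' z', m')"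
      using reaches_trans[OF fetch[unfolded if_P[OF True]] r] True by (simp add: e)
    then have "reaches rvc_prog (length (e # es) * (2 * s + 30) + 2)
        (16, ram n k N j s b p x y q z, m)
        (if guess_ok s b M (e # es) then 50 else 10, ram n k N j s' b' p' x' y' q' z', m')"
      by (rule reaches_mono) simp
    then show ?thesis using inv unfolding M_def by blast
  next
    case False
    define d where "d = s mod 3"
    define t where "t = s div 3"
    have d: "d = 0 \<or> d = 1 \<or> d = 2" unfolding d_def by linarith
    have t: "5 * t \<le> 2 * s" unfolding t_def by linarith
    have "reaches rvc_prog (15 + (5 * t + 2)) (16, ram n k N j s b p x y q z, m)
        (36, ram n k N j d b (Suc (Suc p)) (u + n) (v + n) t 0, m)"
      using reaches_trans[OF fetch[unfolded if_not_P[OF False]] division_loop] q0 False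
      by (simp add: d_def t_def)
    then have digit: "reaches rvc_prog (17 + 2 * s) (16, ram n k N j s b p x y q z, m)
        (36, ram n k N j d b (Suc (Suc p)) (u + n) (v + n) t 0, m)"
      by (rule reaches_mono) (use t in simp)
    show ?thesis
    proof (cases "b = 0 \<or> b = 1 \<and> d \<noteq> 0")
      case fail: True
      then have ng: "\<not> guess_ok s b M (e # es)" using False by (auto simp: e d_def)
      obtain b' where "reaches rvc_prog 11
          (36, ram n k N j d b (Suc (Suc p)) (u + n) (v + n) t 0, m)
          (10, ram n k N j d b' (Suc (Suc p)) (u + n) (v + n) t 0, m)"
        using branch_fail[OF fail] by blast
      from reaches_trans[OF digit this]
      have "reaches rvc_prog (length (e # es) * (2 * s + 30) + 2)
          (16, ram n k N j s b p x y q z, m)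
          (if guess_ok s b M (e # es) then 50 else 10,
           ram n k N j d b' (Suc (Suc p)) (u + n) (v + n) t 0, m)"
        unfolding if_not_P[OF ng] by (rule reaches_mono) simp
      then show ?thesis using Cons.prems(3) unfolding M_def by blast
    next
      case go: False
      \<comment> \<open>Both successful decisions are brought to one form, so that the induction
        hypothesis is applied only once.\<close>
      obtain c m1 M1 where
        branch: "reaches rvc_prog 11
          (36, ram n k N j d b (Suc (Suc p)) (u + n) (v + n) t 0, m)
          (16, ram n k N j t c (Suc (Suc p)) (u + n) (v + n) t 0, m1)"
        and m1: "\<forall>a<n. m1 a = m a" "\<forall>a\<ge>n. m1 a \<le> j"
        and M1: "M1 = {v. m1 (v + n) = j}"
        and ok: "guess_ok s b M (e # es) = guess_ok t c M1 es"
      proof (cases "d = 0")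
        case True
        then obtain c where b: "b = Suc c" using go by (cases b) auto
        show ?thesis
        proof (rule that[of c m M])
          show "reaches rvc_prog 11
              (36, ram n k N j d b (Suc (Suc p)) (u + n) (v + n) t 0, m)
              (16, ram n k N j t c (Suc (Suc p)) (u + n) (v + n) t 0, m)"
            unfolding b True by (rule branch_edge)
        qed (use Cons.prems(3) False True in \<open>auto simp: M_def e b d_def t_def\<close>)
      next
        case d0: False
        then obtain c where b: "b = Suc (Suc c)"
          using go by (metis One_nat_def not0_implies_Suc)
        have d12: "d = 1 \<or> d = 2" using d d0 by simp
        define w where "w = (if d = 1 then u else v)"
        have wn: "(if d = 1 then u + n else v + n) = w + n" by (simp add: w_def)
        show ?thesis
        proof (rule that[of c "m(w + n := j)" "insert w M"])
          show "reaches rvc_prog 11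
              (36, ram n k N j d b (Suc (Suc p)) (u + n) (v + n) t 0, m)
              (16, ram n k N j t c (Suc (Suc p)) (u + n) (v + n) t 0, m(w + n := j))"
            unfolding b wn[symmetric] by (rule branch_vertex[OF d12])
          show "guess_ok s b M (e # es) = guess_ok t c (insert w M) es"
            using False d0 by (simp add: e b w_def flip: d_def t_def)
        qed (use Cons.prems(3) in \<open>auto simp: M_def\<close>)
      qed
      have "edges_at m1 (Suc (Suc p)) es"
        using at(3) edges_at_cong[of "Suc (Suc p)" es m1 m] m1(1) n by simp
      then obtain s' b' p' x' y' q' z' m' where
        r: "reaches rvc_prog (length es * (2 * t + 30) + 2)
            (16, ram n k N j t c (Suc (Suc p)) (u + n) (v + n) t 0, m1)
          (if guess_ok t c M1 es then 50 else 10, ram n k N j s' b' p' x' y' q' z', m')"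
        and inv: "\<forall>a<n. m' a = m1 a" "\<forall>a\<ge>n. m' a \<le> j"
        using IH[of m1, where s = t and b = c and x = "u + n" and y = "v + n"
            and q = t and z = 0] m1(2) unfolding M1 by blast
      have "length es * (2 * t + 30) \<le> length es * (2 * s + 30)"
        using t by (intro mult_le_mono2) simp
      then have "reaches rvc_prog (length (e # es) * (2 * s + 30) + 2)
          (16, ram n k N j s b p x y q z, m)
          (if guess_ok s b M (e # es) then 50 else 10, ram n k N j s' b' p' x' y' q' z', m')"
        unfolding ok
        by (intro reaches_mono[OF reaches_trans[OF digit reaches_trans[OF branch r]]])
          (unfold list.size mult_Suc add_Suc_right add_0_right, linarith)
      then show ?thesis using inv m1(1) unfolding M_def by metis
    qed
  qed
qed

section \<open>Running through all guesses\<close>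

text \<open>Induction on the number \<open>l\<close> of guesses left. A round takes 8 steps besides
  its edges and accepting one more, within the allowance of 10; the final 4 steps reject.\<close>

lemma try_guesses:
  assumes "edges_at m 3 es" and "n = 3 + 2 * length es" and "\<And>a. n \<le> a \<Longrightarrow> m a \<le> i"
    and "i + l = N"
  shows "\<exists>r m'. reaches rvc_prog (l * (length es * (2 * N + 30) + 10) + 4)
      (10, ram n k N i s b p x y q z, m) (51, r, m') \<and>
    r 0 = (if \<exists>s\<in>{i..<N}. guess_ok s k {} es then 1 else 0)"
  using assms
proof (induction l arbitrary: m i s b p x y q z)
  case 0
  have "(step rvc_prog ^^ 4) (10, ram n k N i s b p x y q z, m) =
      (51, ram 0 k N i 0 b p x y q z, m)"
    using 0 by (simp add: exec_simps rvc_prog_def)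
  note r = reachesI[OF this]
  show ?case
    by (rule exI[of _ "ram 0 k N i 0 b p x y q z"], rule exI[of _ m]) (use r 0 in \<open>simp add: regs_nth\<close>)
next
  case (Suc l)
  have "(step rvc_prog ^^ 6) (10, ram n k N i s b p x y q z, m) =
      (16, ram n k N (Suc i) i k 3 x y q z, m)"
    using Suc.prems(4) by (simp add: exec_simps rvc_prog_def)
  note start = reachesI[OF this]
  have le: "m a \<le> Suc i" if "n \<le> a" for a
    using Suc.prems(3)[OF that] by simp
  \<comment> \<open>The round writes \<open>Suc i\<close> while old marks are at most
    \<open>i\<close>, so it starts with no vertex marked.\<close>
  have "m (v + n) \<noteq> Suc i" for v
    using Suc.prems(3)[of "v + n"] by simp
  then have M: "{v. m (v + n) = Suc i} = {}" by blast
  obtain s' b' p' x' y' q' z' m' where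
    r: "reaches rvc_prog (length es * (2 * i + 30) + 2)
        (16, ram n k N (Suc i) i k 3 x y q z, m)
      (if guess_ok i k {} es then 50 else 10, ram n k N (Suc i) s' b' p' x' y' q' z', m')"
    and inv: "\<forall>a<n. m' a = m a" "\<forall>a\<ge>n. m' a \<le> Suc i"
    using scan_edges[OF Suc.prems(1,2) le, where k = k and N = N and s = i and b = k
        and x = x and y = y and q = q and z = z] unfolding M by blast
  have "length es * (2 * i + 30) \<le> length es * (2 * N + 30)"
    using Suc.prems(4) by (intro mult_le_mono2) simp
  then have round: "reaches rvc_prog (length es * (2 * N + 30) + 8)
      (10, ram n k N i s b p x y q z, m)
      (if guess_ok i k {} es then 50 else 10, ram n k N (Suc i) s' b' p' x' y' q' z', m')"
    by (intro reaches_mono[OF reaches_trans[OF start r]]) simp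
  show ?case
  proof (cases "guess_ok i k {} es")
    case True
    have "(step rvc_prog ^^ 1) (50, ram n k N (Suc i) s' b' p' x' y' q' z', m') =
        (51, ram 1 k N (Suc i) s' b' p' x' y' q' z', m')"
      by (simp add: exec_simps rvc_prog_def)
    from reaches_trans[OF round[unfolded if_P[OF True]] reachesI[OF this]]
    have "reaches rvc_prog (Suc l * (length es * (2 * N + 30) + 10) + 4)
        (10, ram n k N i s b p x y q z, m) (51, ram 1 k N (Suc i) s' b' p' x' y' q' z', m')"
      by (rule reaches_mono) simp
    moreover have "\<exists>s\<in>{i..<N}. guess_ok s k {} es"
      using True Suc.prems(4) by (intro bexI[of _ i]) auto
    ultimately show ?thesis
      by (intro exI[of _ "ram 1 k N (Suc i) s' b' p' x' y' q' z'"] exI[of _ m'])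
        (simp add: regs_nth)
  next
    case False
    have "edges_at m' 3 es"
      using Suc.prems(1) edges_at_cong[of 3 es m' m] inv(1) Suc.prems(2) by simp
    then obtain r m'' where
      r: "reaches rvc_prog (l * (length es * (2 * N + 30) + 10) + 4)
        (10, ram n k N (Suc i) s' b' p' x' y' q' z', m') (51, r, m'')"
      "r 0 = (if \<exists>s\<in>{Suc i..<N}. guess_ok s k {} es then 1 else 0)"
      using Suc.IH[of m' "Suc i" s' b' p' x' y' q' z'] Suc.prems(2,4) inv(2) by auto
    have "{i..<N} = insert i {Suc i..<N}" using Suc.prems(4) by auto
    then have "(\<exists>s\<in>{i..<N}. guess_ok s k {} es) = (\<exists>s\<in>{Suc i..<N}. guess_ok s k {} es)"
      using False by simp
    moreover have "reaches rvc_prog (Suc l * (length es * (2 * N + 30) + 10) + 4)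
        (10, ram n k N i s b p x y q z, m) (51, r, m'')"
      by (rule reaches_mono[OF reaches_trans[OF round[unfolded if_not_P[OF False]] r(1)]]) simp
    ultimately show ?thesis using r(2) by metis
  qed
qed

section \<open>Input layout and running time\<close>

lemma edges_at_nth:
  "(\<And>a. a < 2 * length es \<Longrightarrow> m (p + a) = concat (map (\<lambda>(i, j). [i, j]) es) ! a) \<Longrightarrow>
    edges_at m p es"
proof (induction m p es rule: edges_at.induct)
  case (2 m p u v es)
  have "edges_at m (Suc (Suc p)) es"
    using "2.prems"[of "Suc (Suc _)"] by (intro "2.IH") simp
  then show ?case using "2.prems"[of 0] "2.prems"[of 1] by simp
qed simp

lemma length_concat_pairs: "length (concat (map (\<lambda>(i, j). [i, j]) es)) = 2 * length es"
  by (induction es) auto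

text \<open>The 10 outside the loops is 5 steps of set-up, 1 for leaving the power loop and 4 for
  rejecting.\<close>

lemma rvc_prog_computes:
  fixes es :: "(nat \<times> nat) list"
  assumes xs: "xs = k # l # length es # concat (map (\<lambda>(i, j). [i, j]) es)"
  shows "computes_within rvc_prog xs
    (5 * k + 10 + 3 ^ k * (length es * (2 * 3 ^ k + 30) + 10))
    (if \<exists>s<3 ^ k. guess_ok s k {} es then 1 else 0)"
proof -
  define n where "n = length xs"
  define m where "m = (\<lambda>a. if a < length xs then xs ! a else 0)"
  have n: "n = 3 + 2 * length es"
    by (simp add: n_def xs length_concat_pairs)
  have edges: "edges_at m 3 es"
  proof (rule edges_at_nth)
    fix a assume "a < 2 * length es"
    then show "m (3 + a) = concat (map (\<lambda>(i, j). [i, j]) es) ! a"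
      using n by (simp add: m_def flip: n_def) (simp add: xs)
  qed
  have "m 0 = k" by (simp add: m_def xs)
  moreover have "init_config xs = (0, regs [n, 0, 0, 0, 0, 0, 0, 0, 0, 0, 0, 0, 0, 0], m)"
    unfolding init_config_regs[of xs 13] n_def m_def by (simp add: numeral_eq_Suc)
  ultimately have "(step rvc_prog ^^ 5) (init_config xs) = (5, ram n k 1 0 k 0 0 0 0 0 0, m)"
    by (simp add: exec_simps rvc_prog_def)
  note init = reachesI[OF this]
  obtain b where pow: "reaches rvc_prog (5 * k + 1) (5, ram n k 1 0 k 0 0 0 0 0 0, m)
      (10, ram n k (1 * 3 ^ k) 0 0 b 0 0 0 0 0, m)"
    using power_loop by blast
  \<comment> \<open>Cells beyond the input hold 0, never a valid mark, as the first round writes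
    1.\<close>
  have "m a \<le> 0" if "n \<le> a" for a using that by (simp add: m_def n_def)
  then obtain r m' where
    r: "reaches rvc_prog (3 ^ k * (length es * (2 * 3 ^ k + 30) + 10) + 4)
      (10, ram n k (1 * 3 ^ k) 0 0 b 0 0 0 0 0, m) (51, r, m')"
    and r0: "r 0 = (if \<exists>s\<in>{0..<3 ^ k}. guess_ok s k {} es then 1 else 0)"
    using try_guesses[OF edges n, of 0 "3 ^ k" "3 ^ k" k 0 b 0 0 0 0 0] by auto
  show ?thesis
  proof (rule computes_withinI)
    show "reaches rvc_prog (5 * k + 10 + 3 ^ k * (length es * (2 * 3 ^ k + 30) + 10))
        (init_config xs) (51, r, m')"
      by (rule reaches_mono[OF reaches_trans[OF init reaches_trans[OF pow r]]]) simp
    show "length rvc_prog \<le> 51" by (simp add: rvc_prog_def)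
    show "r 0 = (if \<exists>s<3 ^ k. guess_ok s k {} es then 1 else 0)"
      using r0 by (auto simp: atLeast0LessThan)
  qed
qed

lemma computes_within_mono:
  assumes "computes_within P xs t y" and "t \<le> u"
  shows "computes_within P xs u y"
proof -
  obtain pc r m where c: "(step P ^^ t) (init_config xs) = (pc, r, m)" by (metis prod_cases3)
  then show ?thesis
    using assms computes_withinI[OF reaches_mono[OF reachesI[OF c] assms(2)]]
    by (simp add: computes_within_def halted_def)
qed

text \<open>With \<open>N = 3 ^ k\<close>, each of 1, \<open>k\<close> and \<open>N\<close> is at
  most \<open>N * N = 9 ^ k\<close>. The coefficients are 25 = 5 + 10 + 10 and 32 = 2 + 30.\<close>

lemma time_bound:
  fixes k l z :: nat
  assumes "l \<le> z"
  shows "5 * k + 10 + 3 ^ k * (l * (2 * 3 ^ k + 30) + 10) \<le> 9 ^ k * (25 + 32 * z)"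
proof -
  define N :: nat where "N = 3 ^ k"
  have N: "k \<le> N" "1 \<le> N" unfolding N_def by (simp_all add: less_imp_le)
  have NN: "9 ^ k = N * N" unfolding N_def by (simp flip: power_mult_distrib)
  have sq: "N \<le> N * N" using N(2) by simp
  have "N * (l * (2 * N + 30)) \<le> N * (z * (2 * N + 30 * N))"
    using assms N(2) by (intro mult_le_mono add_le_mono) auto
  also have "\<dots> = N * N * (32 * z)" by (simp add: algebra_simps)
  finally have "N * (l * (2 * N + 30)) \<le> N * N * (32 * z)" .
  moreover have "5 * k + 10 + N * 10 \<le> 25 * (N * N)" using N sq by linarith
  ultimately show ?thesis
    unfolding NN N_def[symmetric] by (simp add: algebra_simps)
qed

theorem theorem24:
  shows "fixed_parameter_tractable rvc_instances rvc_encoding rvc_yes rvc_parameter rvc_size"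
  unfolding fixed_parameter_tractable_def
proof (intro exI[of _ rvc_prog] exI[of _ "\<lambda>k. 9 ^ k"] exI[of _ "[:25, 32:]"] conjI
    computable_pow9 ballI allI impI)
  fix i xs
  assume i: "i \<in> rvc_instances" and enc: "rvc_encoding i xs"
  obtain V E k where VEk: "i = (V, E, k)" by (cases i)
  have G: "graph V E" using i by (simp add: VEk rvc_instances_def)
  obtain vs es where vs: "distinct vs" "set vs = V"
    and es: "\<forall>(i, j)\<in>set es. i < length vs \<and> j < length vs"
    and d: "distinct (map (\<lambda>(i, j). {vs ! i, vs ! j}) es)"
    and E: "set (map (\<lambda>(i, j). {vs ! i, vs ! j}) es) = E"
    and xs: "xs = k # length vs # length es # concat (map (\<lambda>(i, j). [i, j]) es)"
    using enc unfolding VEk rvc_encoding_def prod.case by blast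
  \<comment> \<open>The encoding lists each edge once, so the size of the instance bounds the number
    of edges scanned.\<close>
  have "card E = length es" using distinct_card[OF d] E by simp
  then have "length es \<le> rvc_size i" by (simp add: VEk rvc_size_def)
  from computes_within_mono[OF rvc_prog_computes[OF xs] time_bound[OF this]]
  show "computes_within rvc_prog xs (9 ^ rvc_parameter i * poly [:25, 32:] (rvc_size i))
      (if i \<in> rvc_yes then 1 else 0)"
    unfolding guess_ok_iff_rvc_yes[OF G vs es d E]
    by (simp add: VEk rvc_parameter_def mult.commute)
qed

end
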